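(* Let $X=\{x\in\mathbb{R}^n : Ax=b,\ x\geq 0\}$ with $A\in\mathbb{Q}^{m\times n}$, $b\in\mathbb{Q}^m$, let $c_1,c_2,d_1\in\mathbb{Q}^n$ be (row) objective vectors, and let $j\in\{1,2\}$. If $\lambda\ge 0$ is a breakpoint of $\mathrm{PBLP}^j$, then there exists at least one extreme weight $w^*\in\mathcal{W}(\mathrm{TOLP})$ that lies on the line segment of $\mathrm{PBLP}^j(\lambda)$, i.e. $(w_1^*,w_2^* )\in\mathcal{L}_{\mathcal{W}(\mathrm{PBLP}^j(\lambda))}$.
   Context: For a parameter value $\lambda$, $\mathrm{PBLP}^1(\lambda)$ is the biobjective linear program $\min_{x\in X}(c_1x+\lambda d_1x,\ c_2x)^\top$ and $\mathrm{PBLP}^2(\lambda)$ is $\min_{x\in X}(c_1x+\lambda d_1x,\ c_2x+\lambda d_1x)^\top$. TOLP is the triobjective linear program $\min_{x\in X}(c_1x,c_2x,d_1x)^\top$, with image set $Y=\{(c_1x,c_2x,d_1x)^\top:x\in X\}$. Solution sets: for a multi-objective linear program $\min_{x\in X}Cx$, an image $y^*\in\{Cx:x\in X\}$ is nondominated if no other image $y\ne y^*$ satisfies $y_i\le y^*_i$ for all $i$, and it is an extreme nondominated image if it is also an extreme point of the image set. A solution set is a set $S\subseteq X$ containing, for every extreme nondominated image $y$, some $x$ with $Cx=y$; it is minimal if no solution set has smaller cardinality. One writes $S(\mathrm{PBLP}^j(\lambda_1))\neq S(\mathrm{PBLP}^j(\lambda_2))$ if the biobjective programs $\mathrm{PBLP}^j(\lambda_1)$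 and $\mathrm{PBLP}^j(\lambda_2)$ have no minimal solution set in common. Breakpoint: $\lambda\ge 0$ is a breakpoint of $\mathrm{PBLP}^j$ if for all sufficiently small $\varepsilon>0$, $S(\mathrm{PBLP}^j(\lambda+\varepsilon))\ne S(\mathrm{PBLP}^j(\lambda-\varepsilon))$. Weights: $\mathcal{W}(\mathrm{TOLP})=\{w^*\in\mathbb{R}^3: w^*_i\ge 0,\ w_1^*+w_2^*+w_3^*=1\}$. The weight set component of $y\in Y$ is $\mathcal{W}(y)=\{w\in\mathcal{W}(\mathrm{TOLP}): w^\top y=\min\{w^\top y':y'\in Y\}\}$. An extreme weight is an extreme point of some weight set component $\mathcal{W}(y)$. Line segments (projections to the first two coordinates of the weight sets of $\mathrm{PBLP}^j(\lambda)$ inside $\mathcal{W}(\mathrm{TOLP})$): $\mathcal{L}_{\mathcal{W}(\mathrm{PBLP}^1(\lambda))}=\{(w_1^*,w_2^* ): w^*\in\mathcal{W}(\mathrm{TOLP}),\ w_1^*(1+\lambda)+w_2^*=1\}$ and $\mathcal{L}_{\mathcal{W}(\mathrm{PBLP}^2(\lambda))}=\{(w_1^*,w_2^* ): w^*\in\mathcal{W}(\mathrm{TOLP}),\ w_1^*+w_2^*=\frac{1}{1+\lambda}\}$. *)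

theory Defs
  imports "HOL-Analysis.Analysis" "HOL-Library.Equipollence"
begin

definition feasible_set :: "real^'n^'m \<Rightarrow> real^'m \<Rightarrow> (real^'n) set" where
  "feasible_set A b = {x. A *v x = b \<and> (\<forall>i. 0 \<le> x $ i)}"

text \<open>A multi-objective linear program \<open>min {C x | x \<in> X}\<close> is given by its feasible set \<open>X\<close>
  and its objective matrix \<open>C\<close>, whose rows are the objective vectors.\<close>

definition images :: "(real^'n) set \<Rightarrow> real^'n^'p \<Rightarrow> (real^'p) set" where
  "images X C = (\<lambda>x. C *v x) ` X"

definition nondominated :: "(real^'n) set \<Rightarrow> real^'n^'p \<Rightarrow> real^'p \<Rightarrow> bool" where
  "nondominated X C y \<longleftrightarrow>
     y \<in> images X C \<and> \<not> (\<exists>y'\<in>images X C. y' \<noteq> y \<and> (\<forall>i. y' $ i \<le> y $ i))"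

definition extreme_nondominated :: "(real^'n) set \<Rightarrow> real^'n^'p \<Rightarrow> real^'p \<Rightarrow> bool" where
  "extreme_nondominated X C y \<longleftrightarrow> nondominated X C y \<and> y extreme_point_of (images X C)"

definition solution_set :: "(real^'n) set \<Rightarrow> real^'n^'p \<Rightarrow> (real^'n) set \<Rightarrow> bool" where
  "solution_set X C S \<longleftrightarrow> S \<subseteq> X \<and> (\<forall>y. extreme_nondominated X C y \<longrightarrow> (\<exists>x\<in>S. C *v x = y))"

text \<open>Solution sets may be infinite, so cardinalities are compared by \<open>\<prec>\<close>; the function
  \<open>card\<close> would give an infinite set the cardinality \<open>0\<close>.\<close>

definition minimal_solution_set :: "(real^'n) set \<Rightarrow> real^'n^'p \<Rightarrow> (real^'n) set \<Rightarrow> bool" where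
  "minimal_solution_set X C S \<longleftrightarrow>
     solution_set X C S \<and> \<not> (\<exists>T. solution_set X C T \<and> T \<prec> S)"

definition pblp :: "nat \<Rightarrow> real^'n \<Rightarrow> real^'n \<Rightarrow> real^'n \<Rightarrow> real \<Rightarrow> real^'n^2" where
  "pblp j c1 c2 d1 \<mu> =
     (if j = 1 then vector [c1 + \<mu> *\<^sub>R d1, c2]
      else vector [c1 + \<mu> *\<^sub>R d1, c2 + \<mu> *\<^sub>R d1])"

definition tolp :: "real^'n \<Rightarrow> real^'n \<Rightarrow> real^'n \<Rightarrow> real^'n^3" where
  "tolp c1 c2 d1 = vector [c1, c2, d1]"

text \<open>At \<open>\<mu> = 0\<close> the programs with the negative parameters \<open>- \<epsilon>\<close> are used as well.\<close>

definition breakpoint ::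
  "(real^'n) set \<Rightarrow> nat \<Rightarrow> real^'n \<Rightarrow> real^'n \<Rightarrow> real^'n \<Rightarrow> real \<Rightarrow> bool" where
  "breakpoint X j c1 c2 d1 \<mu> \<longleftrightarrow>
     0 \<le> \<mu> \<and>
     (\<exists>\<epsilon>\<^sub>0>0. \<forall>\<epsilon>. 0 < \<epsilon> \<and> \<epsilon> < \<epsilon>\<^sub>0 \<longrightarrow>
        \<not> (\<exists>S. minimal_solution_set X (pblp j c1 c2 d1 (\<mu> + \<epsilon>)) S \<and>
               minimal_solution_set X (pblp j c1 c2 d1 (\<mu> - \<epsilon>)) S))"

definition weights :: "(real^3) set" where
  "weights = {w. (\<forall>i. 0 \<le> w $ i) \<and> w $ 1 + w $ 2 + w $ 3 = 1}"

text \<open>For \<open>y \<in> Y\<close>, the condition says that \<open>w \<bullet> y\<close> is the (attained) minimum of \<open>w \<bullet> y'\<close>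
  over \<open>y' \<in> Y\<close>.\<close>

definition weight_component :: "(real^3) set \<Rightarrow> real^3 \<Rightarrow> (real^3) set" where
  "weight_component Y y = {w \<in> weights. \<forall>y'\<in>Y. w \<bullet> y \<le> w \<bullet> y'}"

definition extreme_weight :: "(real^3) set \<Rightarrow> real^3 \<Rightarrow> bool" where
  "extreme_weight Y w \<longleftrightarrow> (\<exists>y\<in>Y. w extreme_point_of (weight_component Y y))"

definition weight_segment :: "nat \<Rightarrow> real \<Rightarrow> (real \<times> real) set" where
  "weight_segment j \<mu> =
     (if j = 1 then {(w $ 1, w $ 2) | w. w \<in> weights \<and> w $ 1 * (1 + \<mu>) + w $ 2 = 1}
      else {(w $ 1, w $ 2) | w. w \<in> weights \<and> w $ 1 + w $ 2 = 1 / (1 + \<mu>)})"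

end

theory Submission imports Defs begin

text \<open>
  A weight of a biobjective program \<open>PBLP\<^sup>j(\<mu>)\<close> is a weight of the triobjective program on the plane
  \<open>w\<^sub>3 = \<mu> w\<^sub>1\<close> or \<open>w\<^sub>3 = \<mu> (w\<^sub>1 + w\<^sub>2)\<close>. An image of \<open>v\<close> under \<open>PBLP\<^sup>j(\<mu>)\<close> is extreme nondominated
  iff the weight component of \<open>v\<close> meets this plane in a nondegenerate segment, and finitely many
  points \<open>v\<close> represent all such images for all \<open>\<mu>\<close>. Suppose that no weight component, a compact convex
  set, has an extreme point on the plane of \<open>\<kappa>\<close>. If a component misses the plane, it misses all
  nearby ones. Otherwise the plane does not support it, so it has points on both sides of the plane;
  if it meets the plane in a segment, it meets the nearby planes in segments, and if it meets the
  plane in a single point, which is not extreme, it lies on a line and meets the nearby planes in at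
  most one point. In each case the same points \<open>v\<close> represent the extreme nondominated images
  for \<open>\<kappa> + \<epsilon>\<close> and for \<open>\<kappa> - \<epsilon>\<close>, and \<open>\<kappa>\<close> is not a breakpoint.
\<close>

section \<open>Extreme nondominated images in the plane\<close>

text \<open>Up to sign the normal cone of \<open>Y\<close> at \<open>y\<close>. Weights are neither
  normalized nor restricted in sign, so that negative parameters fit in.\<close>

definition supporting_cone :: "'a::real_inner set \<Rightarrow> 'a \<Rightarrow> 'a set" where
  "supporting_cone Y y = {w. \<forall>y'\<in>Y. w \<bullet> y \<le> w \<bullet> y'}"

text \<open>The determinant condition is linear independence of \<open>u\<close> and
  \<open>u'\<close>: after normalization, the nonnegative weights supporting \<open>z\<close> fill a
  nondegenerate segment.\<close>

definition widely_supported :: "(real^2) set \<Rightarrow> real^2 \<Rightarrow> bool" where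
  "widely_supported Z z \<longleftrightarrow>
     (\<exists>u\<in>supporting_cone Z z. \<exists>u'\<in>supporting_cone Z z.
        (\<forall>i. 0 \<le> u $ i) \<and> (\<forall>i. 0 \<le> u' $ i) \<and> u $ 1 * u' $ 2 \<noteq> u $ 2 * u' $ 1)"

lemma inner_vec2: "(x::real^2) \<bullet> y = x $ 1 * y $ 1 + x $ 2 * y $ 2"
  by (simp add: inner_vec_def sum_2)

lemma inner_vec3: "(x::real^3) \<bullet> y = x $ 1 * y $ 1 + x $ 2 * y $ 2 + x $ 3 * y $ 3"
  by (simp add: inner_vec_def sum_3)

lemma closed_supporting_cone: "closed (supporting_cone Y y)"
proof -
  have "supporting_cone Y y = (\<Inter>y'\<in>Y. {w. (y - y') \<bullet> w \<le> 0})"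
    by (auto simp: supporting_cone_def inner_diff_right inner_commute)
  then show ?thesis
    by (auto intro: closed_halfspace_le)
qed

lemma supporting_cone_add:
  "\<lbrakk>w \<in> supporting_cone Y y; w' \<in> supporting_cone Y y\<rbrakk> \<Longrightarrow> w + w' \<in> supporting_cone Y y"
  by (fastforce simp: supporting_cone_def inner_add_left)

lemma supporting_cone_scaleR:
  "\<lbrakk>w \<in> supporting_cone Y y; 0 \<le> r\<rbrakk> \<Longrightarrow> r *\<^sub>R w \<in> supporting_cone Y y"
  by (simp add: supporting_cone_def mult_left_mono)

lemma eq_if_inner_eq_independent:
  fixes u u' z z' :: "real^2"
  assumes "u \<bullet> z = u \<bullet> z'" "u' \<bullet> z = u' \<bullet> z'" "u $ 1 * u' $ 2 \<noteq> u $ 2 * u' $ 1"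
  shows "z = z'"
proof -
  have e: "u $ 1 * (z $ 1 - z' $ 1) + u $ 2 * (z $ 2 - z' $ 2) = 0"
          "u' $ 1 * (z $ 1 - z' $ 1) + u' $ 2 * (z $ 2 - z' $ 2) = 0"
    using assms(1,2) by (simp_all add: inner_vec2 algebra_simps)
  have "(u $ 1 * u' $ 2 - u $ 2 * u' $ 1) * (z $ 1 - z' $ 1) = 0"
       "(u $ 1 * u' $ 2 - u $ 2 * u' $ 1) * (z $ 2 - z' $ 2) = 0"
    using e by algebra+
  then show ?thesis
    using assms(3) by (simp add: vec_eq_iff forall_2)
qed

text \<open>As \<open>z\<close> minimizes both functionals, a point no worse for their sum ties with
  \<open>z\<close> in each, and two independent functionals separate the points of the
  plane.\<close>

lemma minimizer_of_sum_eq: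
  fixes z z' :: "real^2"
  assumes u: "u \<in> supporting_cone Z z" "u' \<in> supporting_cone Z z"
    and "u $ 1 * u' $ 2 \<noteq> u $ 2 * u' $ 1"
    and z': "z' \<in> Z" "(u + u') \<bullet> z' \<le> (u + u') \<bullet> z"
  shows "z' = z"
proof -
  have "u \<bullet> z \<le> u \<bullet> z'" "u' \<bullet> z \<le> u' \<bullet> z'"
    using u z' by (auto simp: supporting_cone_def)
  then have "u \<bullet> z' = u \<bullet> z" "u' \<bullet> z' = u' \<bullet> z"
    using z'(2) by (auto simp: inner_add_left)
  then show ?thesis
    using eq_if_inner_eq_independent assms(3) by blast
qed

text \<open>The functional \<open>u + u'\<close> has \<open>z\<close> as its unique minimizer. A
  dominating image would be no worse for it because the weights are nonnegative, and the ends of a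
  segment through \<open>z\<close> would be minimizers too.\<close>

lemma widely_supported_imp_extreme_nondominated:
  assumes "z \<in> images X C" "widely_supported (images X C) z"
  shows "extreme_nondominated X C z"
proof -
  obtain u u' where u: "u \<in> supporting_cone (images X C) z" "u' \<in> supporting_cone (images X C) z"
    and pos: "\<And>i. 0 \<le> u $ i" "\<And>i. 0 \<le> u' $ i" and det: "u $ 1 * u' $ 2 \<noteq> u $ 2 * u' $ 1"
    using assms(2) by (auto simp: widely_supported_def)
  have eq: "z' = z" if "z' \<in> images X C" "(u + u') \<bullet> z' \<le> (u + u') \<bullet> z" for z'
    using minimizer_of_sum_eq[OF u det that] .
  have "nondominated X C z"
    unfolding nondominated_def
  proof (intro conjI notI assms(1); clarify)
    fix z' assume z': "z' \<in> images X C" "z' \<noteq> z" "\<forall>i. z' $ i \<le> z $ i"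
    have "(u + u') \<bullet> z' \<le> (u + u') \<bullet> z"
      unfolding inner_vec2 using z'(3) pos by (intro add_mono mult_left_mono) auto
    then show False using eq z' by blast
  qed
  moreover have "z extreme_point_of images X C"
    unfolding extreme_point_of_def
  proof (intro conjI assms(1) ballI notI)
    fix p q assume pq: "p \<in> images X C" "q \<in> images X C" and seg: "z \<in> open_segment p q"
    obtain t where t: "0 < t" "t < 1" "z = (1 - t) *\<^sub>R p + t *\<^sub>R q" and ne: "p \<noteq> q"
      using seg by (auto simp: in_segment)
    let ?w = "u + u'"
    have w: "?w \<bullet> z \<le> ?w \<bullet> p" "?w \<bullet> z \<le> ?w \<bullet> q"
      using supporting_cone_add[OF u] pq by (auto simp: supporting_cone_def)
    have "?w \<bullet> z = (1 - t) * (?w \<bullet> p) + t * (?w \<bullet> q)"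
      by (subst t(3)) (simp add: inner_add_right)
    then have "(1 - t) * (?w \<bullet> p - ?w \<bullet> z) + t * (?w \<bullet> q - ?w \<bullet> z) = 0"
      by (simp add: algebra_simps)
    moreover have "0 \<le> (1 - t) * (?w \<bullet> p - ?w \<bullet> z)" "0 \<le> t * (?w \<bullet> q - ?w \<bullet> z)"
      using t w by simp_all
    ultimately have "(1 - t) * (?w \<bullet> p - ?w \<bullet> z) = 0" "t * (?w \<bullet> q - ?w \<bullet> z) = 0"
      by linarith+
    then have "?w \<bullet> p = ?w \<bullet> z" "?w \<bullet> q = ?w \<bullet> z"
      using t by auto
    then have "p = z" "q = z"
      using eq pq by auto
    then show False using ne by simp
  qed
  ultimately show ?thesis
    by (simp add: extreme_nondominated_def)
qed

text \<open>If \<open>z\<close> is a proper convex combination of sums, the part from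
  \<open>Z\<close> is componentwise at most \<open>z\<close> and hence equals \<open>z\<close>. The
  nonnegative parts from the square then vanish, which leaves a segment with ends in
  \<open>Z\<close>.\<close>

lemma nondominated_extreme_point_of_sums:
  fixes Z :: "(real^2) set"
  assumes z: "z extreme_point_of Z"
    and nd: "\<And>z'. \<lbrakk>z' \<in> Z; \<forall>i. z' $ i \<le> z $ i\<rbrakk> \<Longrightarrow> z' = z"
    and "convex Z"
  shows "z extreme_point_of {y + s |y s. y \<in> Z \<and> s \<in> cbox 0 1}"
  unfolding extreme_point_of_def
proof (intro conjI ballI notI)
  have zZ: "z \<in> Z" using z by (simp add: extreme_point_of_def)
  show "z \<in> {y + s |y s. y \<in> Z \<and> s \<in> cbox 0 1}"
    using zZ by (force simp: mem_box_cart intro: exI[of _ z] exI[of _ 0])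
  fix p q assume "p \<in> {y + s |y s. y \<in> Z \<and> s \<in> cbox 0 1}" "q \<in> {y + s |y s. y \<in> Z \<and> s \<in> cbox 0 1}"
    and seg: "z \<in> open_segment p q"
  then obtain y s y' s' where y: "y \<in> Z" "y' \<in> Z" and s: "\<And>i. 0 \<le> s $ i" "\<And>i. 0 \<le> s' $ i"
    and pq: "p = y + s" "q = y' + s'"
    unfolding mem_box_cart by fastforce
  obtain t where t: "0 < t" "t < 1" "z = (1 - t) *\<^sub>R p + t *\<^sub>R q" and ne: "p \<noteq> q"
    using seg by (auto simp: in_segment)
  let ?y = "(1 - t) *\<^sub>R y + t *\<^sub>R y'" and ?s = "(1 - t) *\<^sub>R s + t *\<^sub>R s'"
  have sum: "z = ?y + ?s" by (simp add: t(3) pq algebra_simps)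
  have yZ: "?y \<in> Z" using \<open>convex Z\<close> y t by (simp add: convex_alt)
  have spos: "0 \<le> ?s $ i" for i using s t by simp
  have yz: "?y = z"
    using spos by (intro nd[OF yZ]) (simp add: sum)
  have s0: "?s = 0" using sum unfolding yz by simp
  have "s $ i = 0 \<and> s' $ i = 0" for i
  proof -
    have "(1 - t) * s $ i + t * s' $ i = 0" using arg_cong[OF s0, of "\<lambda>v. v $ i"] by simp
    moreover have "0 \<le> (1 - t) * s $ i" "0 \<le> t * s' $ i" using s t by simp_all
    ultimately have "(1 - t) * s $ i = 0" "t * s' $ i = 0" by linarith+
    then show ?thesis using t by simp
  qed
  then have "s = 0" "s' = 0" by (simp_all add: vec_eq_iff)
  then have "z \<in> open_segment y y'" using seg pq by simp
  then show False using z y by (auto simp: extreme_point_of_def)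
qed

text \<open>Adding the unit square forces an exposing functional to be positive; as a polytope has only
  finitely many vertices, the functional may then be perturbed.\<close>

lemma extreme_nondominated_widely_supported_polytope:
  fixes Z :: "(real^2) set"
  assumes "polytope Z" and z: "z extreme_point_of Z"
    and nd: "\<And>z'. \<lbrakk>z' \<in> Z; \<forall>i. z' $ i \<le> z $ i\<rbrakk> \<Longrightarrow> z' = z"
  shows "widely_supported Z z"
proof -
  define Q where "Q = {y + s |y s. y \<in> Z \<and> s \<in> cbox 0 (1::real^2)}"
  have zZ: "z \<in> Z" using z by (simp add: extreme_point_of_def)
  have "Q = (\<lambda>p. fst p + snd p) ` (Z \<times> cbox 0 1)"
    by (force simp: Q_def)
  moreover have "linear (\<lambda>p::(real^2) \<times> (real^2). fst p + snd p)"
    by (intro linear_compose_add linear_fst linear_snd)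
  ultimately have polyQ: "polytope Q"
    using assms(1) by (auto intro!: polytope_linear_image polytope_Times polytope_interval)
  have "z extreme_point_of Q"
    unfolding Q_def using nondominated_extreme_point_of_sums[OF z nd polytope_imp_convex[OF assms(1)]]
    by blast
  \<comment> \<open>Faces of a polyhedron are exposed, so \<open>z\<close> is the unique maximizer
    of a linear functional.\<close>
  then have "{z} exposed_face_of Q"
    using polyQ by (simp add: exposed_face_of_polyhedron polytope_imp_polyhedron face_of_singleton)
  then obtain a \<beta> where a: "Q \<subseteq> {x. a \<bullet> x \<le> \<beta>}" "{z} = Q \<inter> {x. a \<bullet> x = \<beta>}"
    by (auto simp: exposed_face_of_def)
  have strict: "- a \<bullet> z < - a \<bullet> q" if "q \<in> Q" "q \<noteq> z" for q
  proof -
    have "a \<bullet> q \<le> \<beta>" "a \<bullet> q \<noteq> \<beta>" "a \<bullet> z = \<beta>" using a that by blast+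
    then show ?thesis by simp
  qed
  have ZQ: "Z \<subseteq> Q"
    unfolding Q_def by (force simp: mem_box_cart intro: exI[of _ 0])
  define u where "u = - a"
  have upos: "0 < u $ i" for i
  proof -
    have "z + axis i 1 \<in> Q"
      unfolding Q_def using zZ by (force simp: mem_box_cart axis_def)
    moreover have "z + axis i 1 \<noteq> z" by (simp add: axis_eq_0_iff)
    ultimately show ?thesis
      using strict[of "z + axis i 1"] by (simp add: u_def inner_add_right inner_axis)
  qed
  obtain E where E: "finite E" "Q = convex hull E"
    using polyQ by (auto simp: polytope_def)
  \<comment> \<open>Finitely many strict inequalities survive a small shift of \<open>u\<close>. A
    shift of the first coordinate by \<delta> gives the determinant
    \<open>- \<delta> * u $ 2\<close>, which is nonzero.\<close>
  have "\<forall>\<^sub>F \<delta> in at_right 0. \<forall>e\<in>E. e \<noteq> z \<longrightarrow> 0 < (u + \<delta> *\<^sub>R axis 1 1) \<bullet> (e - z)"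
  proof (intro eventually_ball_finite[OF E(1)] ballI)
    fix e assume "e \<in> E"
    show "\<forall>\<^sub>F \<delta> in at_right 0. e \<noteq> z \<longrightarrow> 0 < (u + \<delta> *\<^sub>R axis 1 1) \<bullet> (e - z)"
    proof (cases "e = z")
      case False
      have "e \<in> Q" using \<open>e \<in> E\<close> E(2) by (simp add: hull_inc)
      then have "0 < u \<bullet> (e - z)" using strict[of e] False by (simp add: u_def inner_diff_right)
      moreover have "((\<lambda>\<delta>. (u + \<delta> *\<^sub>R axis 1 1) \<bullet> (e - z)) \<longlongrightarrow> (u + 0 *\<^sub>R axis 1 1) \<bullet> (e - z)) (at_right 0)"
        by (intro tendsto_intros)
      ultimately show ?thesis by (auto dest: order_tendstoD(1)[where a = 0] elim: eventually_mono)
    qed simp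
  qed
  then have "\<forall>\<^sub>F \<delta> in at_right 0. 0 < \<delta> \<and> (\<forall>e\<in>E. e \<noteq> z \<longrightarrow> 0 < (u + \<delta> *\<^sub>R axis 1 1) \<bullet> (e - z))"
    by (intro eventually_conj eventually_at_right_less)
  then obtain \<delta> :: real where \<delta>: "0 < \<delta>"
    and pert: "\<And>e. \<lbrakk>e \<in> E; e \<noteq> z\<rbrakk> \<Longrightarrow> 0 < (u + \<delta> *\<^sub>R axis 1 1) \<bullet> (e - z)"
    using eventually_happens'[OF trivial_limit_at_right_real] by blast
  define u' where "u' = u + \<delta> *\<^sub>R axis 1 1"
  have "u' \<bullet> z \<le> u' \<bullet> e" if "e \<in> E" for e
    using pert[OF that] by (cases "e = z") (auto simp: u'_def inner_diff_right)
  then have "Q \<subseteq> {x. u' \<bullet> x \<ge> u' \<bullet> z}"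
    unfolding E(2) by (intro hull_minimal convex_halfspace_ge) auto
  then have "u' \<in> supporting_cone Z z" using ZQ by (auto simp: supporting_cone_def)
  moreover have "u \<in> supporting_cone Z z"
    using ZQ strict by (force simp: supporting_cone_def u_def)
  moreover have "u' $ 1 = u $ 1 + \<delta>" "u' $ 2 = u $ 2"
    by (simp_all add: u'_def axis_def)
  moreover have "u $ 1 * u $ 2 \<noteq> u $ 2 * (u $ 1 + \<delta>)"
    using upos[of 2] \<delta> by (simp add: algebra_simps)
  ultimately show ?thesis
    unfolding widely_supported_def forall_2
    using upos \<delta> by (intro bexI[of _ u] bexI[of _ u']) (auto simp: less_imp_le add_nonneg_nonneg)
qed

text \<open>Truncating \<open>X\<close> by a box around a preimage makes it a polytope and, by convexity, does not
  enlarge the set of supporting functionals.\<close>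

lemma extreme_nondominated_imp_widely_supported:
  fixes X :: "(real^'n) set" and C :: "real^'n^2"
  assumes X: "polyhedron X" and z: "extreme_nondominated X C z"
  shows "widely_supported (images X C) z"
proof -
  have zext: "z extreme_point_of images X C" and nd: "nondominated X C z"
    using z by (auto simp: extreme_nondominated_def)
  obtain x0 where x0: "x0 \<in> X" "z = C *v x0"
    using nd by (auto simp: nondominated_def images_def)
  define B where "B = cbox (x0 - 1) (x0 + 1)"
  define Z where "Z = images (X \<inter> B) C"
  have "polytope (X \<inter> B)"
    unfolding B_def using X by (simp add: polyhedron_Int_polytope polytope_interval)
  then have polyZ: "polytope Z"
    unfolding Z_def images_def by (intro polytope_linear_image) simp_all
  have x0B: "x0 \<in> B" by (simp add: B_def mem_box_cart)
  have sub: "Z \<subseteq> images X C" by (auto simp: Z_def images_def)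
  have "z \<in> Z" using x0 x0B by (auto simp: Z_def images_def)
  then have "z extreme_point_of Z" using zext sub by (auto simp: extreme_point_of_def)
  moreover have "z' = z" if "z' \<in> Z" "\<forall>i. z' $ i \<le> z $ i" for z'
    using nd that sub by (auto simp: nondominated_def)
  ultimately have wide: "widely_supported Z z"
    using extreme_nondominated_widely_supported_polytope[OF polyZ] by blast
  have ext: "u \<in> supporting_cone (images X C) z" if u: "u \<in> supporting_cone Z z" for u
    unfolding supporting_cone_def
  proof (intro CollectI ballI)
    fix z' assume "z' \<in> images X C"
    then obtain x where x: "x \<in> X" "z' = C *v x" by (auto simp: images_def)
    \<comment> \<open>Small enough to keep \<open>x0 + s * (x - x0)\<close> in the box, since the
      norm bounds every coordinate; the summand 1 ensures \<open>s \<le> 1\<close> and covers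
      \<open>x = x0\<close>.\<close>
    define s where "s = 1 / (1 + norm (x - x0))"
    have s: "0 < s" "s \<le> 1" "s * norm (x - x0) \<le> 1"
      by (auto simp: s_def field_simps add_pos_nonneg)
    define y where "y = (1 - s) *\<^sub>R x0 + s *\<^sub>R x"
    have "y \<in> X"
      using polyhedron_imp_convex[OF X] x x0 s by (simp add: convex_alt y_def)
    moreover have "y \<in> B"
    proof -
      have "\<bar>s * (x - x0) $ i\<bar> \<le> 1" for i
      proof -
        have "\<bar>s * (x - x0) $ i\<bar> = s * \<bar>(x - x0) $ i\<bar>" using s by (simp add: abs_mult)
        also have "\<dots> \<le> s * norm (x - x0)"
          using s by (intro mult_left_mono component_le_norm_cart) auto
        finally show ?thesis using s by linarith
      qed
      then have "\<bar>y $ i - x0 $ i\<bar> \<le> 1" for i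
        by (simp add: y_def algebra_simps)
      then show ?thesis
        unfolding B_def mem_box_cart by (simp add: abs_le_iff) (smt (verit))
    qed
    ultimately have "C *v y \<in> Z" by (auto simp: Z_def images_def)
    then have "u \<bullet> z \<le> u \<bullet> (C *v y)" using u by (auto simp: supporting_cone_def)
    also have "C *v y = (1 - s) *\<^sub>R z + s *\<^sub>R z'"
      by (simp add: y_def x0 x matrix_vector_right_distrib matrix_vector_mult_scaleR)
    finally have "s * (u \<bullet> z) \<le> s * (u \<bullet> z')" by (simp add: inner_add_right algebra_simps)
    then show "u \<bullet> z \<le> u \<bullet> z'" using s by simp
  qed
  show ?thesis
    using wide ext unfolding widely_supported_def by blast
qed

section \<open>Finitely many representatives and minimal solution sets\<close>

lemma polyhedron_feasible_set: "polyhedron (feasible_set A b)"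
proof -
  have "feasible_set A b =
      (\<Inter>i. {x. (A $ i) \<bullet> x = b $ i}) \<inter> (\<Inter>i. {x. axis i 1 \<bullet> x \<ge> 0})"
    by (auto simp: feasible_set_def vec_eq_iff matrix_vector_mul_component inner_axis')
  then show ?thesis
    by (auto intro!: polyhedron_Inter polyhedron_hyperplane polyhedron_halfspace_ge)
qed

text \<open>One point from each face suffices, since the minimizers of a linear functional form a face.\<close>

lemma finite_minimizers_polyhedron:
  fixes X :: "'a::euclidean_space set"
  assumes "polyhedron X"
  obtains V where "finite V" "V \<subseteq> X"
    "\<And>c x. \<lbrakk>x \<in> X; \<And>x'. x' \<in> X \<Longrightarrow> c \<bullet> x \<le> c \<bullet> x'\<rbrakk> \<Longrightarrow> \<exists>v\<in>V. c \<bullet> v = c \<bullet> x"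
proof
  let ?V = "(\<lambda>F. SOME x. x \<in> F) ` {F. F face_of X \<and> F \<noteq> {}}"
  have "finite {F. F face_of X \<and> F \<noteq> {}}"
    using finite_polyhedron_faces[OF assms] by (rule rev_finite_subset) auto
  then show "finite ?V" by simp
  show "?V \<subseteq> X"
  proof (clarify)
    fix F assume "F face_of X" "F \<noteq> {}"
    then show "(SOME x. x \<in> F) \<in> X"
      using face_of_imp_subset[of F X] some_in_eq[of F] by blast
  qed
  fix c x assume x: "x \<in> X" and min: "\<And>x'. x' \<in> X \<Longrightarrow> c \<bullet> x \<le> c \<bullet> x'"
  let ?F = "X \<inter> {x'. c \<bullet> x' = c \<bullet> x}"
  have "?F face_of X"
    using min assms by (intro face_of_Int_supporting_hyperplane_ge polyhedron_imp_convex) auto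
  moreover have "?F \<noteq> {}" using x by auto
  moreover have "(SOME x. x \<in> ?F) \<in> ?F" using \<open>?F \<noteq> {}\<close> some_in_eq[of ?F] by blast
  ultimately show "\<exists>v\<in>?V. c \<bullet> v = c \<bullet> x"
    by (intro bexI[of _ "SOME x. x \<in> ?F"] image_eqI[of _ _ ?F]) auto
qed

text \<open>The image \<open>z\<close> uniquely minimizes \<open>u + u'\<close>, so every minimizer
  over \<open>X\<close> of this functional pulled back along \<open>C\<close> is mapped to
  \<open>z\<close>. The set \<open>V\<close> contains a minimizer of each linear functional that
  attains its minimum on \<open>X\<close>, and it is chosen before \<open>C\<close>, hence serves
  all parameters at once.\<close>

lemma extreme_nondominated_finite_representatives:
  fixes X :: "(real^'n) set"
  assumes "polyhedron X"
  shows "\<exists>V. finite V \<and> V \<subseteq> X \<and> (\<forall>C :: real^'n^2. {z. extreme_nondominated X C z} =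
       (\<lambda>v. C *v v) ` {v \<in> V. widely_supported (images X C) (C *v v)})"
proof -
  obtain V where V: "finite V" "V \<subseteq> X"
    and min: "\<And>c x. \<lbrakk>x \<in> X; \<And>x'. x' \<in> X \<Longrightarrow> c \<bullet> x \<le> c \<bullet> x'\<rbrakk> \<Longrightarrow> \<exists>v\<in>V. c \<bullet> v = c \<bullet> x"
    using finite_minimizers_polyhedron[OF assms] by metis
  have "\<exists>v\<in>V. C *v v = z \<and> widely_supported (images X C) (C *v v)"
    if z: "extreme_nondominated X C z" for C :: "real^'n^2" and z
  proof -
    have wide: "widely_supported (images X C) z"
      using extreme_nondominated_imp_widely_supported[OF assms z] .
    then obtain u u' where u: "u \<in> supporting_cone (images X C) z" "u' \<in> supporting_cone (images X C) z"
      and det: "u $ 1 * u' $ 2 \<noteq> u $ 2 * u' $ 1"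
      by (auto simp: widely_supported_def)
    obtain x where x: "x \<in> X" "z = C *v x"
      using z by (auto simp: extreme_nondominated_def nondominated_def images_def)
    have tr: "(transpose C *v w) \<bullet> x = w \<bullet> (C *v x)" for w x
      by (metis dot_lmul_matrix inner_commute transpose_matrix_vector)
    have "(u + u') \<bullet> z \<le> (u + u') \<bullet> (C *v x')" if "x' \<in> X" for x'
      using supporting_cone_add[OF u] that by (auto simp: supporting_cone_def images_def)
    then obtain v where v: "v \<in> V" "(u + u') \<bullet> (C *v v) = (u + u') \<bullet> z"
      using min[of x "transpose C *v (u + u')"] x unfolding tr by auto
    have "C *v v \<in> images X C" using v V by (auto simp: images_def)
    then have "C *v v = z" using minimizer_of_sum_eq[OF u det] v by simp
    then show ?thesis using v wide by auto
  qed
  moreover have "extreme_nondominated X C (C *v v)"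
    if "v \<in> V" "widely_supported (images X C) (C *v v)" for C :: "real^'n^2" and v
    using that V by (intro widely_supported_imp_extreme_nondominated) (auto simp: images_def)
  ultimately show ?thesis
    using V by (intro exI[of _ V] conjI allI) (auto simp: image_iff)
qed

text \<open>Every solution set maps onto a superset of the extreme nondominated images, while
  \<open>S\<close> has exactly one point for each of them.\<close>

lemma minimal_solution_set_if_inj_on:
  assumes "S \<subseteq> X" "inj_on (\<lambda>x. C *v x) S" "(\<lambda>x. C *v x) ` S = {z. extreme_nondominated X C z}"
  shows "minimal_solution_set X C S"
  unfolding minimal_solution_set_def
proof (intro conjI notI)
  show "solution_set X C S" using assms by (force simp: solution_set_def)
  assume "\<exists>T. solution_set X C T \<and> T \<prec> S"
  then obtain T where T: "solution_set X C T" "T \<prec> S" by blast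
  have "(\<lambda>x. C *v x) ` S \<subseteq> (\<lambda>x. C *v x) ` T"
    using T(1) unfolding assms(3) by (force simp: solution_set_def)
  then have "(\<lambda>x. C *v x) ` S \<lesssim> T"
    by (meson image_lepoll lepoll_trans subset_imp_lepoll)
  then have "S \<lesssim> T"
    by (rule iffD1[OF inj_on_image_lepoll_1[OF assms(2)]])
  then show False
    using T(2) by (meson lepoll_antisym lesspoll_def)
qed

section \<open>Weight components and moving lines\<close>

text \<open>In the objective of the biobjective program weighted by \<open>w $ 1\<close> and
  \<open>w $ 2\<close>, the vector \<open>d1\<close> has the coefficient
  \<open>\<mu> * line_slope j w\<close>.\<close>

definition line_slope :: "nat \<Rightarrow> real^3 \<Rightarrow> real" where
  "line_slope j w = (if j = 1 then w $ 1 else w $ 1 + w $ 2)"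

text \<open>The zero set is the plane of the parameter \<mu>, and the sign tells the side of the
  plane. The form is linear in \<open>w\<close> and affine in \<mu>.\<close>

definition line_form :: "nat \<Rightarrow> real \<Rightarrow> real^3 \<Rightarrow> real" where
  "line_form j \<mu> w = w $ 3 - \<mu> * line_slope j w"

text \<open>The third coordinate may be negative: the breakpoint \<open>0\<close> involves negative parameters.\<close>

definition meets_line_widely :: "nat \<Rightarrow> real \<Rightarrow> (real^3) set \<Rightarrow> bool" where
  "meets_line_widely j \<mu> K \<longleftrightarrow>
     (\<exists>w\<in>K. \<exists>w'\<in>K. 0 \<le> w $ 1 \<and> 0 \<le> w $ 2 \<and> 0 \<le> w' $ 1 \<and> 0 \<le> w' $ 2 \<and>
        line_form j \<mu> w = 0 \<and> line_form j \<mu> w' = 0 \<and> w $ 1 * w' $ 2 \<noteq> w $ 2 * w' $ 1)"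

lemma line_slope_nonneg: "\<lbrakk>0 \<le> w $ 1; 0 \<le> w $ 2\<rbrakk> \<Longrightarrow> 0 \<le> line_slope j w"
  by (simp add: line_slope_def)

lemma line_form_add [simp]: "line_form j \<mu> (v + w) = line_form j \<mu> v + line_form j \<mu> w"
  by (simp add: line_form_def line_slope_def algebra_simps)

lemma line_form_scaleR [simp]: "line_form j \<mu> (r *\<^sub>R w) = r * line_form j \<mu> w"
  by (simp add: line_form_def line_slope_def algebra_simps)

lemma line_form_eq_inner: "line_form j \<mu> w = vector [- \<mu>, if j = 1 then 0 else - \<mu>, 1] \<bullet> w"
  by (simp add: line_form_def line_slope_def inner_vec3 algebra_simps)

lemma tendsto_line_form [tendsto_intros]:
  "(f \<longlongrightarrow> l) F \<Longrightarrow> ((\<lambda>x. line_form j (f x) w) \<longlongrightarrow> line_form j l w) F"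
  unfolding line_form_def by (intro tendsto_intros)

lemma weight_segment_iff:
  assumes "w \<in> weights" "0 \<le> \<mu>"
  shows "(w $ 1, w $ 2) \<in> weight_segment j \<mu> \<longleftrightarrow> line_form j \<mu> w = 0"
proof (cases "j = 1")
  case True
  have "(w $ 1, w $ 2) \<in> weight_segment j \<mu> \<longleftrightarrow> w $ 1 * (1 + \<mu>) + w $ 2 = 1"
    using assms True by (auto simp: weight_segment_def)
  then show ?thesis
    using assms True by (auto simp: line_form_def line_slope_def weights_def algebra_simps)
next
  case False
  have "(w $ 1, w $ 2) \<in> weight_segment j \<mu> \<longleftrightarrow> w $ 1 + w $ 2 = 1 / (1 + \<mu>)"
    using assms False by (auto simp: weight_segment_def)
  also have "\<dots> \<longleftrightarrow> (w $ 1 + w $ 2) * (1 + \<mu>) = 1"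
    using assms by (simp add: eq_divide_eq)
  finally show ?thesis
    using assms False by (auto simp: line_form_def line_slope_def weights_def algebra_simps)
qed

section \<open>Comparison of biobjective and triobjective weights\<close>

lemma tolp_mult_nth [simp]:
  "(tolp c1 c2 d1 *v x) $ 1 = c1 \<bullet> x" "(tolp c1 c2 d1 *v x) $ 2 = c2 \<bullet> x"
  "(tolp c1 c2 d1 *v x) $ 3 = d1 \<bullet> x"
  by (simp_all add: tolp_def matrix_vector_mul_component)

lemma pblp_mult_nth:
  "(pblp j c1 c2 d1 \<mu> *v x) $ 1 = c1 \<bullet> x + \<mu> * (d1 \<bullet> x)"
  "(pblp j c1 c2 d1 \<mu> *v x) $ 2 = c2 \<bullet> x + (if j = 1 then 0 else \<mu> * (d1 \<bullet> x))"
  by (simp_all add: pblp_def matrix_vector_mul_component inner_add_left)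

lemma inner_pblp_eq_inner_tolp:
  assumes "line_form j \<mu> w = 0" "u $ 1 = w $ 1" "u $ 2 = w $ 2"
  shows "u \<bullet> (pblp j c1 c2 d1 \<mu> *v x) = w \<bullet> (tolp c1 c2 d1 *v x)"
proof -
  have "w $ 3 = \<mu> * line_slope j w" using assms by (simp add: line_form_def)
  then show ?thesis
    using assms by (simp add: inner_vec2 inner_vec3 pblp_mult_nth line_slope_def algebra_simps)
qed

text \<open>On the plane of \<mu> the third coordinate is determined by the first two, and the two
  weighted objectives agree there. Lifting and projecting (\<open>up\<close> and
  \<open>down\<close>) therefore match the supporting weights of both programs.\<close>

lemma widely_supported_pblp_iff:
  "widely_supported (images X (pblp j c1 c2 d1 \<mu>)) (pblp j c1 c2 d1 \<mu> *v v) \<longleftrightarrow>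
   meets_line_widely j \<mu> (supporting_cone (images X (tolp c1 c2 d1)) (tolp c1 c2 d1 *v v))"
  (is "widely_supported ?Z ?z \<longleftrightarrow> meets_line_widely j \<mu> ?K")
proof -
  have K: "u \<in> supporting_cone ?Z ?z \<longleftrightarrow> w \<in> ?K"
    if "line_form j \<mu> w = 0" "u $ 1 = w $ 1" "u $ 2 = w $ 2" for u w
    using inner_pblp_eq_inner_tolp[OF that, of c1 c2 d1] by (simp add: supporting_cone_def images_def)
  define up :: "real^2 \<Rightarrow> real^3"
    where "up u = vector [u $ 1, u $ 2, \<mu> * (if j = 1 then u $ 1 else u $ 1 + u $ 2)]" for u
  define down :: "real^3 \<Rightarrow> real^2" where "down w = vector [w $ 1, w $ 2]" for w
  have up: "up u $ 1 = u $ 1" "up u $ 2 = u $ 2" "line_form j \<mu> (up u) = 0" for u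
    by (simp_all add: up_def line_form_def line_slope_def)
  have down: "down w $ 1 = w $ 1" "down w $ 2 = w $ 2" for w
    by (simp_all add: down_def)
  show ?thesis
  proof
    assume "widely_supported ?Z ?z"
    then obtain u u' where u: "u \<in> supporting_cone ?Z ?z" "u' \<in> supporting_cone ?Z ?z"
      "\<forall>i. 0 \<le> u $ i" "\<forall>i. 0 \<le> u' $ i" "u $ 1 * u' $ 2 \<noteq> u $ 2 * u' $ 1"
      unfolding widely_supported_def by blast
    then have "up u \<in> ?K" "up u' \<in> ?K" using K up by metis+
    then show "meets_line_widely j \<mu> ?K"
      unfolding meets_line_widely_def using u
      by (intro bexI[of _ "up u"] bexI[of _ "up u'"]) (auto simp: up)
  next
    assume "meets_line_widely j \<mu> ?K"
    then obtain w w' where w: "w \<in> ?K" "w' \<in> ?K" "0 \<le> w $ 1" "0 \<le> w $ 2" "0 \<le> w' $ 1" "0 \<le> w' $ 2"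
        "line_form j \<mu> w = 0" "line_form j \<mu> w' = 0" "w $ 1 * w' $ 2 \<noteq> w $ 2 * w' $ 1"
      unfolding meets_line_widely_def by blast
    then have "down w \<in> supporting_cone ?Z ?z" "down w' \<in> supporting_cone ?Z ?z"
      using K down by metis+
    then show "widely_supported ?Z ?z"
      unfolding widely_supported_def using w
      by (intro bexI[of _ "down w"] bexI[of _ "down w'"]) (auto simp: down forall_2)
  qed
qed

section \<open>Weight components as compact convex sets\<close>

lemma weight_component_eq: "weight_component Y y = weights \<inter> supporting_cone Y y"
  by (auto simp: weight_component_def supporting_cone_def)

lemma weights_nonneg: "w \<in> weights \<Longrightarrow> 0 \<le> w $ i"
  by (simp add: weights_def)

lemma weights_sum: "w \<in> weights \<Longrightarrow> w $ 1 + w $ 2 + w $ 3 = 1"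
  by (simp add: weights_def)

lemma compact_weights: "compact weights"
proof -
  have "weights = cbox 0 1 \<inter> {w. vector [1, 1, 1] \<bullet> w = (1::real)}"
    by (auto simp: weights_def mem_box_cart forall_3 inner_vec3)
  then show ?thesis
    by (metis compact_Int_closed compact_cbox closed_hyperplane)
qed

lemma convex_weights: "convex weights"
proof -
  have eq: "weights = (\<Inter>i. {w. axis i 1 \<bullet> w \<ge> 0}) \<inter> {w. vector [1, 1, 1] \<bullet> w = (1::real)}"
    by (auto simp: weights_def inner_vec3[of "vector [1, 1, 1]"] inner_axis')
  show ?thesis
    unfolding eq by (intro convex_Int convex_INT convex_halfspace_ge convex_hyperplane)
qed

lemma compact_weight_component: "compact (weight_component Y y)"
  by (simp add: weight_component_eq compact_Int_closed compact_weights closed_supporting_cone)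

lemma convex_weight_component: "convex (weight_component Y y)"
proof -
  have "convex (supporting_cone Y y)"
    by (auto simp: convex_alt intro!: supporting_cone_add supporting_cone_scaleR)
  then show ?thesis
    by (simp add: weight_component_eq convex_Int convex_weights)
qed

lemma supporting_cone_normalize:
  assumes "w \<in> supporting_cone Y y" "\<And>i. 0 \<le> w $ i" "w $ 1 + w $ 2 + w $ 3 \<noteq> 0"
  shows "(1 / (w $ 1 + w $ 2 + w $ 3)) *\<^sub>R w \<in> weight_component Y y"
proof -
  let ?s = "w $ 1 + w $ 2 + w $ 3"
  have "0 < ?s" using assms(2)[of 1] assms(2)[of 2] assms(2)[of 3] assms(3) by linarith
  moreover have "w $ 1 / ?s + w $ 2 / ?s + w $ 3 / ?s = 1"
    using assms(3) by (simp add: add_divide_distrib[symmetric])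
  ultimately show ?thesis
    using assms by (auto simp: weight_component_eq weights_def intro!: supporting_cone_scaleR)
qed

text \<open>On the plane the third coordinate is a linear function of the first two, so a vanishing
  determinant makes \<open>p\<close> and \<open>q\<close> linearly dependent; both have coordinate
  sum 1 and would coincide.\<close>

lemma line_weights_det_nonzero:
  assumes "p \<in> weights" "q \<in> weights" "line_form j \<mu> p = 0" "line_form j \<mu> q = 0" "p \<noteq> q"
  shows "p $ 1 * q $ 2 \<noteq> p $ 2 * q $ 1"
proof
  assume det: "p $ 1 * q $ 2 = p $ 2 * q $ 1"
  have p3: "p $ 3 = \<mu> * line_slope j p" and q3: "q $ 3 = \<mu> * line_slope j q"
    using assms by (auto simp: line_form_def)
  have ps: "p $ 1 + p $ 2 + p $ 3 = 1" and qs: "q $ 1 + q $ 2 + q $ 3 = 1"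
    using assms weights_sum by auto
  have "p $ 1 = q $ 1" "p $ 2 = q $ 2"
  proof (atomize (full), cases "j = 1")
    case True
    then have "p $ 1 + p $ 2 + \<mu> * p $ 1 = 1" "q $ 1 + q $ 2 + \<mu> * q $ 1 = 1"
      using ps qs by (simp_all add: p3 q3 line_slope_def)
    with det show "p $ 1 = q $ 1 \<and> p $ 2 = q $ 2" by algebra
  next
    case False
    then have "p $ 1 + p $ 2 + \<mu> * (p $ 1 + p $ 2) = 1" "q $ 1 + q $ 2 + \<mu> * (q $ 1 + q $ 2) = 1"
      using ps qs by (simp_all add: p3 q3 line_slope_def)
    with det show "p $ 1 = q $ 1 \<and> p $ 2 = q $ 2" by algebra
  qed
  then have "p = q"
    by (simp add: vec_eq_iff forall_3 p3 q3 line_slope_def)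
  then show False using assms by simp
qed

section \<open>Weight components under small changes of the parameter\<close>

lemma eventually_not_meets_line_widely:
  assumes "0 \<le> \<kappa>" and none: "\<And>w. w \<in> weight_component Y y \<Longrightarrow> line_form j \<kappa> w \<noteq> 0"
  shows "\<forall>\<^sub>F \<mu> in at \<kappa>. \<not> meets_line_widely j \<mu> (supporting_cone Y y)"
proof -
  \<comment> \<open>Parametrizes the points of the plane of \<mu> whose first two coordinates sum to
    1. This normalization, unlike the sum of all three coordinates, also works for every negative
    \<mu>.\<close>
  define w :: "real \<times> real \<Rightarrow> real^3" where
    "w = (\<lambda>(\<mu>, t). (1 - t) *\<^sub>R axis 1 1 + t *\<^sub>R axis 2 1 + (\<mu> * (if j = 1 then 1 - t else 1)) *\<^sub>R axis 3 1)"
  have w: "w (\<mu>, t) $ 1 = 1 - t" "w (\<mu>, t) $ 2 = t" "w (\<mu>, t) $ 3 = \<mu> * (if j = 1 then 1 - t else 1)"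
    "line_form j \<mu> (w (\<mu>, t)) = 0" for \<mu> t
    by (simp_all add: w_def axis_def line_form_def line_slope_def)
  \<comment> \<open>The parameters within distance 1 of \<kappa> whose plane contains such a point
    of the cone. As the projection of a compact set \<open>M\<close> is closed, so it suffices that
    \<kappa> lies outside it.\<close>
  define M where "M = fst ` (({\<kappa> - 1..\<kappa> + 1} \<times> {0..1}) \<inter> w -` supporting_cone Y y)"
  have "continuous_on UNIV w"
    unfolding w_def case_prod_unfold by (cases "j = 1"; simp; intro continuous_intros)
  then have "closed (w -` supporting_cone Y y)"
    by (simp add: closed_supporting_cone continuous_on_closed_vimage)
  then have "compact M"
    unfolding M_def
    by (intro compact_continuous_image continuous_on_fst continuous_on_id compact_Int_closed
        compact_Times compact_Icc)
  then have "open (- M)" by (simp add: compact_imp_closed open_Compl)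
  moreover have "\<kappa> \<notin> M"
  proof
    assume "\<kappa> \<in> M"
    then obtain t where t: "0 \<le> t" "t \<le> 1" "w (\<kappa>, t) \<in> supporting_cone Y y"
      by (auto simp: M_def)
    let ?w = "w (\<kappa>, t)"
    \<comment> \<open>Here \<open>0 \<le> \<kappa>\<close> makes the third coordinate nonnegative,
      so the point rescales to an element of the weight component on the plane.\<close>
    have "0 \<le> ?w $ i" for i
      using t assms(1) w[of \<kappa> t] exhaust_3[of i] by auto
    moreover have "?w $ 1 + ?w $ 2 + ?w $ 3 \<noteq> 0"
      using t assms(1) w[of \<kappa> t] by (smt (verit) mult_nonneg_nonneg)
    ultimately show False
      using none[OF supporting_cone_normalize[OF t(3)]] by (simp add: w)
  qed
  ultimately have "\<forall>\<^sub>F \<mu> in nhds \<kappa>. \<mu> \<in> - M"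
    using eventually_nhds by blast
  moreover have "\<forall>\<^sub>F \<mu> in nhds \<kappa>. \<mu> \<in> {\<kappa> - 1<..<\<kappa> + 1}"
    by (intro eventually_nhds_in_open) auto
  ultimately have "\<forall>\<^sub>F \<mu> in nhds \<kappa>. \<not> meets_line_widely j \<mu> (supporting_cone Y y)"
  proof eventually_elim
    case (elim \<mu>)
    show ?case
    proof
      assume "meets_line_widely j \<mu> (supporting_cone Y y)"
      then obtain v v' :: "real^3" where v: "v \<in> supporting_cone Y y" "0 \<le> v $ 1" "0 \<le> v $ 2"
        "line_form j \<mu> v = 0" "v $ 1 * v' $ 2 \<noteq> v $ 2 * v' $ 1"
        unfolding meets_line_widely_def by blast
      define s where "s = v $ 1 + v $ 2"
      \<comment> \<open>The nonzero determinant excludes that both coordinates of \<open>v\<close>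
        vanish.\<close>
      have "s > 0" using v unfolding s_def by (smt (verit) mult_eq_0_iff)
      have v3: "v $ 3 = \<mu> * line_slope j v" using v(4) by (simp add: line_form_def)
      have "w (\<mu>, v $ 2 / s) = (1 / s) *\<^sub>R v"
        using \<open>s > 0\<close> by (simp add: vec_eq_iff forall_3 w v3 line_slope_def) (simp add: s_def field_simps)
      then have "w (\<mu>, v $ 2 / s) \<in> supporting_cone Y y"
        using \<open>s > 0\<close> v(1) by (simp add: supporting_cone_scaleR)
      moreover have "v $ 2 / s \<in> {0..1}"
        using \<open>s > 0\<close> v by (simp add: s_def)
      ultimately have "\<mu> \<in> M"
        unfolding M_def using elim(2) by (intro image_eqI[of _ _ "(\<mu>, v $ 2 / s)"]) auto
      then show False using elim(1) by simp
    qed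
  qed
  then show ?thesis
    by (simp add: eventually_nhds_conv_at)
qed

text \<open>The points where the segments from \<open>p\<close> and \<open>q\<close> to \<open>a\<close> cross the moved line tend to
  \<open>p\<close> and \<open>q\<close>.\<close>

lemma eventually_meets_line_widely:
  assumes K: "p \<in> supporting_cone Y y" "q \<in> supporting_cone Y y" "a \<in> supporting_cone Y y"
    and W: "p \<in> weights" "q \<in> weights" "a \<in> weights"
    and on: "line_form j \<kappa> p = 0" "line_form j \<kappa> q = 0" "p \<noteq> q" and off: "line_form j \<kappa> a \<noteq> 0"
    and F: "F \<le> nhds \<kappa>"
    and opp: "\<forall>\<^sub>F \<mu> in F. line_form j \<mu> p * line_form j \<mu> a \<le> 0"
      "\<forall>\<^sub>F \<mu> in F. line_form j \<mu> q * line_form j \<mu> a \<le> 0"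
  shows "\<forall>\<^sub>F \<mu> in F. meets_line_widely j \<mu> (supporting_cone Y y)"
proof -
  \<comment> \<open>The crossing point of the segment from \<open>r\<close> to \<open>a\<close> with
    the plane, up to a factor: if the forms at \<open>r\<close> and \<open>a\<close> have opposite
    signs, the two terms cancel. Leaving out the division keeps the expression continuous in
    \<mu>.\<close>
  define c where "c \<mu> r = \<bar>line_form j \<mu> a\<bar> *\<^sub>R r + \<bar>line_form j \<mu> r\<bar> *\<^sub>R a" for \<mu> r
  define D where "D \<mu> = c \<mu> p $ 1 * c \<mu> q $ 2 - c \<mu> p $ 2 * c \<mu> q $ 1" for \<mu>
  have id: "((\<lambda>\<mu>. \<mu>) \<longlongrightarrow> \<kappa>) F" using F by (simp add: filterlim_def)
  have "(D \<longlongrightarrow> D \<kappa>) F"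
    unfolding D_def c_def by (intro tendsto_intros id)
  \<comment> \<open>At \<kappa> the form vanishes at \<open>p\<close> and \<open>q\<close>, so the
    crossing points are positive multiples of \<open>p\<close> and \<open>q\<close>
    themselves.\<close>
  moreover have "D \<kappa> = (line_form j \<kappa> a)\<^sup>2 * (p $ 1 * q $ 2 - p $ 2 * q $ 1)"
    by (simp add: D_def c_def on power2_eq_square algebra_simps)
  then have "D \<kappa> \<noteq> 0"
    using line_weights_det_nonzero[OF W(1,2) on] off by simp
  ultimately have "\<forall>\<^sub>F \<mu> in F. D \<mu> \<noteq> 0"
    by (rule tendsto_imp_eventually_ne)
  then show ?thesis
    using opp
  proof eventually_elim
    case (elim \<mu>)
    have zero: "line_form j \<mu> (c \<mu> r) = 0" if "line_form j \<mu> r * line_form j \<mu> a \<le> 0" for r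
      using that by (auto simp: c_def abs_if mult_le_0_iff)
    have cK: "c \<mu> r \<in> supporting_cone Y y" if "r \<in> supporting_cone Y y" for r
      using that K(3) by (auto simp: c_def intro!: supporting_cone_add supporting_cone_scaleR)
    have nonneg: "0 \<le> c \<mu> r $ i" if "r \<in> weights" for r i
      using weights_nonneg[OF that] weights_nonneg[OF W(3)] by (simp add: c_def)
    show ?case
      unfolding meets_line_widely_def
      using elim zero cK K nonneg W by (intro bexI[of _ "c \<mu> p"] bexI[of _ "c \<mu> q"]) (auto simp: D_def)
  qed
qed

text \<open>A point \<open>z\<close> off the plane is joined to whichever of \<open>a\<close> and
  \<open>b\<close> lies on the other side. The segment crosses the plane inside the component, hence
  at \<open>p\<close>, and \<open>z\<close> is a combination of \<open>p\<close> and that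
  endpoint.\<close>

lemma span_of_crossing_segment:
  assumes K: "a \<in> weight_component Y y" "b \<in> weight_component Y y"
    and only: "\<And>w. \<lbrakk>w \<in> weight_component Y y; line_form j \<kappa> w = 0\<rbrakk> \<Longrightarrow> w = p"
    and ab: "0 < line_form j \<kappa> a" "line_form j \<kappa> b < 0" and p: "p \<in> span {a, b}"
    and z: "z \<in> weight_component Y y"
  shows "z \<in> span {a, b}"
proof -
  have ab_span: "a \<in> span {a, b}" "b \<in> span {a, b}" by (auto intro: span_base)
  have *: "z \<in> span {a, b}"
    if "c \<in> weight_component Y y" "c \<in> span {a, b}" "line_form j \<kappa> z * line_form j \<kappa> c < 0" for c
  proof -
    define f where "f = line_form j \<kappa> z"
    define g where "g = line_form j \<kappa> c"
    have fg: "f * g < 0" using that by (simp add: f_def g_def)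
    \<comment> \<open>The solution of \<open>(1 - t) * f + t * g = 0\<close>; opposite signs place
      it strictly below 1, so that \<open>z\<close> can be recovered by division by
      \<open>1 - t\<close>.\<close>
    define t where "t = f / (f - g)"
    have ne: "f - g \<noteq> 0" using fg by (auto simp: mult_less_0_iff)
    have t: "0 \<le> t" "t < 1"
      using fg by (auto simp: t_def mult_less_0_iff divide_simps)
    let ?r = "(1 - t) *\<^sub>R z + t *\<^sub>R c"
    have "?r \<in> weight_component Y y"
      using convex_weight_component z that(1) t by (simp add: convex_alt)
    moreover have "line_form j \<kappa> ?r = (1 - t) * f + t * g"
      by (simp add: f_def g_def)
    then have "line_form j \<kappa> ?r = 0"
      using ne by (simp add: t_def field_simps)
    ultimately have "?r = p" by (rule only)
    then have "(1 - t) *\<^sub>R z \<in> span {a, b}"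
      using p that(2) by (metis add_diff_cancel_right' span_diff span_mul)
    then have "(1 / (1 - t)) *\<^sub>R (1 - t) *\<^sub>R z \<in> span {a, b}" by (rule span_mul)
    then show ?thesis using t by simp
  qed
  consider "line_form j \<kappa> z = 0" | "line_form j \<kappa> z > 0" | "line_form j \<kappa> z < 0" by linarith
  then show ?thesis
  proof cases
    case 1
    then show ?thesis using only[OF z] p by simp
  next
    case 2
    then show ?thesis using *[OF K(2) ab_span(2)] ab by (simp add: mult_pos_neg)
  next
    case 3
    then show ?thesis using *[OF K(1) ab_span(1)] ab by (simp add: mult_neg_pos)
  qed
qed

text \<open>The form does not vanish at \<open>a\<close>, so its kernel within the span of
  \<open>a\<close> and \<open>b\<close> is at most one-dimensional, and two vectors of the cone on
  the plane have determinant zero.\<close>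

lemma not_meets_line_widely_if_in_span:
  assumes "0 \<le> \<mu>" and sub: "weight_component Y y \<subseteq> span {a, b}"
    and a: "line_form j \<mu> a \<noteq> 0"
  shows "\<not> meets_line_widely j \<mu> (supporting_cone Y y)"
proof
  assume "meets_line_widely j \<mu> (supporting_cone Y y)"
  then obtain w w' where w: "w \<in> supporting_cone Y y" "w' \<in> supporting_cone Y y"
    "0 \<le> w $ 1" "0 \<le> w $ 2" "0 \<le> w' $ 1" "0 \<le> w' $ 2"
    "line_form j \<mu> w = 0" "line_form j \<mu> w' = 0" and det: "w $ 1 * w' $ 2 \<noteq> w $ 2 * w' $ 1"
    unfolding meets_line_widely_def by blast
  have "\<exists>\<alpha> \<beta>. v = \<alpha> *\<^sub>R a + \<beta> *\<^sub>R b"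
    if v: "v \<in> supporting_cone Y y" "0 \<le> v $ 1" "0 \<le> v $ 2" "line_form j \<mu> v = 0"
      "v $ 1 \<noteq> 0 \<or> v $ 2 \<noteq> 0" for v
  proof -
    \<comment> \<open>With a nonnegative third coordinate \<open>v\<close> rescales to a weight of
      the component, which puts it into the span.\<close>
    have v3: "0 \<le> v $ 3"
      using v(4) assms(1) line_slope_nonneg[OF v(2,3), of j] by (simp add: line_form_def)
    have s: "v $ 1 + v $ 2 + v $ 3 \<noteq> 0" using v v3 by linarith
    have "(1 / (v $ 1 + v $ 2 + v $ 3)) *\<^sub>R v \<in> span {a, b}"
      using v v3 s sub exhaust_3 by (intro subsetD[OF sub] supporting_cone_normalize) (metis+)
    then have "(v $ 1 + v $ 2 + v $ 3) *\<^sub>R (1 / (v $ 1 + v $ 2 + v $ 3)) *\<^sub>R v \<in> span {a, b}"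
      by (rule span_mul)
    then have "v \<in> span {a, b}" using s by simp
    then obtain \<alpha> where "v - \<alpha> *\<^sub>R a \<in> span {b}" by (auto simp: span_breakdown_eq)
    then obtain \<beta> where "v - \<alpha> *\<^sub>R a = \<beta> *\<^sub>R b" by (auto simp: span_singleton)
    then show ?thesis by (metis add.commute diff_add_cancel)
  qed
  moreover have "w $ 1 \<noteq> 0 \<or> w $ 2 \<noteq> 0" "w' $ 1 \<noteq> 0 \<or> w' $ 2 \<noteq> 0" using det by auto
  ultimately obtain \<alpha> \<beta> \<alpha>' \<beta>' where
    eq: "w = \<alpha> *\<^sub>R a + \<beta> *\<^sub>R b" "w' = \<alpha>' *\<^sub>R a + \<beta>' *\<^sub>R b"
    using w by meson
  have "\<alpha> * line_form j \<mu> a + \<beta> * line_form j \<mu> b = 0"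
       "\<alpha>' * line_form j \<mu> a + \<beta>' * line_form j \<mu> b = 0"
    using w(7,8) by (simp_all add: eq)
  then have "(\<alpha> * \<beta>' - \<alpha>' * \<beta>) * line_form j \<mu> a = 0" by algebra
  then have "\<alpha> * \<beta>' - \<alpha>' * \<beta> = 0" using a by simp
  moreover have "w $ 1 * w' $ 2 - w $ 2 * w' $ 1 = (\<alpha> * \<beta>' - \<alpha>' * \<beta>) * (a $ 1 * b $ 2 - a $ 2 * b $ 1)"
    by (simp add: eq algebra_simps)
  ultimately show False using det by simp
qed

text \<open>If the component lay on one side, its intersection with the plane would be a nonempty
  compact convex face, and an extreme point of this face would be an extreme point of the component
  on the plane.\<close>

lemma weight_component_crosses_line:
  assumes "0 \<le> \<kappa>"
    and noext: "\<And>w. w extreme_point_of weight_component Y y \<Longrightarrow> line_form j \<kappa> w \<noteq> 0"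
    and p: "p \<in> weight_component Y y" "line_form j \<kappa> p = 0"
  obtains a b where "a \<in> weight_component Y y" "b \<in> weight_component Y y"
    "0 < line_form j \<kappa> a" "line_form j \<kappa> b < 0" "0 < \<kappa>"
proof -
  let ?W = "weight_component Y y"
  define n :: "real^3" where "n = vector [- \<kappa>, if j = 1 then 0 else - \<kappa>, 1]"
  have lf: "line_form j \<kappa> w = n \<bullet> w" for w
    by (simp add: line_form_eq_inner n_def)
  have noface: False if "?W \<inter> {w. n \<bullet> w = 0} face_of ?W"
  proof -
    have "compact (?W \<inter> {w. n \<bullet> w = 0})" "convex (?W \<inter> {w. n \<bullet> w = 0})"
      by (simp_all add: compact_Int_closed compact_weight_component closed_hyperplane
          convex_Int convex_weight_component convex_hyperplane)
    moreover have "?W \<inter> {w. n \<bullet> w = 0} \<noteq> {}" using p lf by auto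
    ultimately obtain e where "e extreme_point_of (?W \<inter> {w. n \<bullet> w = 0})"
      using extreme_point_exists_convex by blast
    then show False
      using noext lf extreme_point_of_face[OF that] by auto
  qed
  have "\<exists>a\<in>?W. 0 < line_form j \<kappa> a"
  proof (rule ccontr)
    assume "\<not> ?thesis"
    then have "n \<bullet> w \<le> 0" if "w \<in> ?W" for w using that lf by (metis not_less)
    then show False
      using noface face_of_Int_supporting_hyperplane_le[OF convex_weight_component] by blast
  qed
  moreover have b: "\<exists>b\<in>?W. line_form j \<kappa> b < 0"
  proof (rule ccontr)
    assume "\<not> ?thesis"
    then have "0 \<le> n \<bullet> w" if "w \<in> ?W" for w using that lf by (metis not_less)
    then show False
      using noface face_of_Int_supporting_hyperplane_ge[OF convex_weight_component] by blast
  qed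
  \<comment> \<open>For \<kappa> = 0 the form is the third coordinate, which is never negative on
    weights.\<close>
  moreover have "\<kappa> \<noteq> 0"
    using b by (auto simp: line_form_def weight_component_def weights_def not_less[symmetric])
  ultimately show ?thesis using that assms(1) by force
qed

lemma meets_line_widely_eventually_constant:
  assumes "0 \<le> \<kappa>"
    and noext: "\<And>w. w extreme_point_of weight_component Y y \<Longrightarrow> line_form j \<kappa> w \<noteq> 0"
  shows "\<exists>m. \<forall>\<^sub>F \<mu> in at \<kappa>. meets_line_widely j \<mu> (supporting_cone Y y) \<longleftrightarrow> m"
proof (cases "\<exists>p. p \<in> weight_component Y y \<and> line_form j \<kappa> p = 0")
  case False
  then show ?thesis
    using eventually_not_meets_line_widely[OF assms(1), of Y y j] by (intro exI[of _ False]) auto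
next
  case True
  let ?W = "weight_component Y y"
  obtain p where p: "p \<in> ?W" "line_form j \<kappa> p = 0" using True by blast
  obtain a b where ab: "a \<in> ?W" "b \<in> ?W" "0 < line_form j \<kappa> a" "line_form j \<kappa> b < 0" and "0 < \<kappa>"
    using weight_component_crosses_line[OF assms p] by blast
  show ?thesis
  proof (cases "\<exists>q\<in>?W. line_form j \<kappa> q = 0 \<and> q \<noteq> p")
    case True
    then obtain q where q: "q \<in> ?W" "line_form j \<kappa> q = 0" "q \<noteq> p" by blast
    \<comment> \<open>Points on the plane of \<kappa> have a form at most 0 for larger \<mu> and at
      least 0 for smaller \<mu>. Hence \<open>a\<close> is the opposite point on the right of
      \<kappa>, and \<open>b\<close> on the left.\<close>
    have move: "line_form j \<mu> r = - ((\<mu> - \<kappa>) * line_slope j r)" "0 \<le> line_slope j r"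
      if "r \<in> ?W" "line_form j \<kappa> r = 0" for r \<mu>
      using that line_slope_nonneg[of r j]
      by (auto simp: line_form_def weight_component_def weights_nonneg algebra_simps)
    have right: "\<forall>\<^sub>F \<mu> in at_right \<kappa>. line_form j \<mu> r * line_form j \<mu> a \<le> 0"
      if "r \<in> ?W" "line_form j \<kappa> r = 0" for r
    proof -
      have "((\<lambda>\<mu>. line_form j \<mu> a) \<longlongrightarrow> line_form j \<kappa> a) (at_right \<kappa>)" by (rule tendsto_line_form[OF tendsto_ident_at])
      then have "\<forall>\<^sub>F \<mu> in at_right \<kappa>. 0 < line_form j \<mu> a" using ab by (auto dest: order_tendstoD)
      moreover have "\<forall>\<^sub>F \<mu> in at_right \<kappa>. \<kappa> < \<mu>" by (rule eventually_at_right_less)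
      ultimately show ?thesis
        by eventually_elim (use move[OF that] in \<open>simp add: mult_nonneg_nonneg\<close>)
    qed
    have left: "\<forall>\<^sub>F \<mu> in at_left \<kappa>. line_form j \<mu> r * line_form j \<mu> b \<le> 0"
      if "r \<in> ?W" "line_form j \<kappa> r = 0" for r
    proof -
      have "((\<lambda>\<mu>. line_form j \<mu> b) \<longlongrightarrow> line_form j \<kappa> b) (at_left \<kappa>)" by (rule tendsto_line_form[OF tendsto_ident_at])
      then have "\<forall>\<^sub>F \<mu> in at_left \<kappa>. line_form j \<mu> b < 0" using ab by (auto dest: order_tendstoD)
      moreover have "\<forall>\<^sub>F \<mu> in at_left \<kappa>. \<mu> < \<kappa>" by (simp add: eventually_at_filter)
      ultimately show ?thesis
      proof eventually_elim
        case (elim \<mu>)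
        then have "0 \<le> line_form j \<mu> r"
          using move[OF that] by (simp add: mult_nonpos_nonneg)
        then show ?case using elim by (simp add: mult_nonneg_nonpos)
      qed
    qed
    have "\<forall>\<^sub>F \<mu> in at_right \<kappa>. meets_line_widely j \<mu> (supporting_cone Y y)"
      using p q ab right unfolding weight_component_eq
      by (intro eventually_meets_line_widely[where p = p and q = q and a = a and \<kappa> = \<kappa>])
        (auto simp: at_within_def)
    moreover have "\<forall>\<^sub>F \<mu> in at_left \<kappa>. meets_line_widely j \<mu> (supporting_cone Y y)"
      using p q ab left unfolding weight_component_eq
      by (intro eventually_meets_line_widely[where p = p and q = q and a = b and \<kappa> = \<kappa>])
        (auto simp: at_within_def)
    ultimately show ?thesis by (intro exI[of _ True]) (simp add: eventually_at_split)
  next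
    case False
    then have only: "\<And>w. \<lbrakk>w \<in> ?W; line_form j \<kappa> w = 0\<rbrakk> \<Longrightarrow> w = p" by blast
    have "\<not> p extreme_point_of ?W" using noext p by blast
    then obtain c d where cd: "c \<in> ?W" "d \<in> ?W" "p \<in> open_segment c d"
      using p by (auto simp: extreme_point_of_def)
    then obtain t where t: "0 < t" "t < 1" "p = (1 - t) *\<^sub>R c + t *\<^sub>R d" and "c \<noteq> d"
      by (auto simp: in_segment)
    have lcd: "(1 - t) * line_form j \<kappa> c + t * line_form j \<kappa> d = 0"
      using p(2) by (simp add: t(3))
    \<comment> \<open>If \<open>c\<close> were on the plane, so would be \<open>d\<close>, and both
      would equal \<open>p\<close> although they are distinct. Thus \<open>c\<close> and
      \<open>d\<close> lie strictly on opposite sides.\<close>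
    have ne: "line_form j \<kappa> c \<noteq> 0"
    proof
      assume c0: "line_form j \<kappa> c = 0"
      then have "line_form j \<kappa> d = 0" using lcd t by simp
      then show False using only cd c0 \<open>c \<noteq> d\<close> by metis
    qed
    have pspan: "p \<in> span {c, d}"
      unfolding t(3) by (intro span_add span_mul span_base) auto
    have sub: "?W \<subseteq> span {c, d}"
    proof (cases "0 < line_form j \<kappa> c")
      case True
      then have "0 < (1 - t) * line_form j \<kappa> c" using t by simp
      then have "t * line_form j \<kappa> d < 0" using lcd by linarith
      then have "line_form j \<kappa> d < 0" using t by (simp add: mult_less_0_iff)
      then show ?thesis using span_of_crossing_segment[OF cd(1,2) only True _ pspan] by blast
    next
      case False
      then have neg: "line_form j \<kappa> c < 0" using ne by simp
      then have "(1 - t) * line_form j \<kappa> c < 0" using t by (simp add: mult_pos_neg)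
      then have "0 < t * line_form j \<kappa> d" using lcd by linarith
      then have pos: "0 < line_form j \<kappa> d" using t by (simp add: zero_less_mult_iff)
      have swap: "span {d, c} = span {c, d}" by (simp add: insert_commute)
      show ?thesis
        using span_of_crossing_segment[OF cd(2,1) only pos neg] pspan unfolding swap by blast
    qed
    have "((\<lambda>\<mu>. line_form j \<mu> c) \<longlongrightarrow> line_form j \<kappa> c) (at \<kappa>)"
      by (rule tendsto_line_form[OF tendsto_ident_at])
    then have "\<forall>\<^sub>F \<mu> in at \<kappa>. line_form j \<mu> c \<noteq> 0" by (rule tendsto_imp_eventually_ne[OF _ ne])
    moreover have "\<forall>\<^sub>F \<mu> in at \<kappa>. 0 < \<mu>"
      using order_tendstoD(1)[OF tendsto_ident_at \<open>0 < \<kappa>\<close>] .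
    ultimately have "\<forall>\<^sub>F \<mu> in at \<kappa>. \<not> meets_line_widely j \<mu> (supporting_cone Y y)"
      by eventually_elim (simp add: not_meets_line_widely_if_in_span[OF _ sub])
    then show ?thesis by (intro exI[of _ False]) simp
  qed
qed

section \<open>Breakpoints\<close>

text \<open>If \<open>d1\<close> takes the same value at both points, the terms with \<mu> cancel.
  Otherwise the first objectives agree for a single parameter only, and the punctured neighbourhood
  allows this to be \<kappa> itself.\<close>

lemma eventually_pblp_eq_iff:
  "\<forall>\<^sub>F \<mu> in at \<kappa>. pblp j c1 c2 d1 \<mu> *v v = pblp j c1 c2 d1 \<mu> *v v' \<longleftrightarrow>
     tolp c1 c2 d1 *v v = tolp c1 c2 d1 *v v'"
proof (cases "d1 \<bullet> v = d1 \<bullet> v'")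
  case True
  then show ?thesis
    by (intro always_eventually) (auto simp: vec_eq_iff forall_2 forall_3 pblp_mult_nth)
next
  case False
  define r where "r = - (c1 \<bullet> v - c1 \<bullet> v') / (d1 \<bullet> v - d1 \<bullet> v')"
  have "\<forall>\<^sub>F \<mu> in at \<kappa>. \<mu> \<noteq> r"
    using eventually_neq_at_within by blast
  then show ?thesis
  proof eventually_elim
    case (elim \<mu>)
    have "c1 \<bullet> v + \<mu> * (d1 \<bullet> v) \<noteq> c1 \<bullet> v' + \<mu> * (d1 \<bullet> v')"
    proof
      assume "c1 \<bullet> v + \<mu> * (d1 \<bullet> v) = c1 \<bullet> v' + \<mu> * (d1 \<bullet> v')"
      then have "\<mu> * (d1 \<bullet> v - d1 \<bullet> v') = - (c1 \<bullet> v - c1 \<bullet> v')" by (simp add: algebra_simps)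
      then show False using elim False by (simp add: r_def eq_divide_eq)
    qed
    then show ?case
      using False by (auto simp: vec_eq_iff forall_2 forall_3 pblp_mult_nth)
  qed
qed

theorem proposition24:
  fixes A :: "real^'n^'m" and b :: "real^'m"
    and c1 c2 d1 :: "real^'n" and X :: "(real^'n) set"
    and j :: nat and \<mu> :: real
  assumes "\<And>i k. A $ i $ k \<in> \<rat>" and "\<And>i. b $ i \<in> \<rat>"
    and "\<And>k. c1 $ k \<in> \<rat>" and "\<And>k. c2 $ k \<in> \<rat>" and "\<And>k. d1 $ k \<in> \<rat>"
    and "X = feasible_set A b"
    and "j \<in> {1, 2}"
    and "0 \<le> \<mu>" and "breakpoint X j c1 c2 d1 \<mu>"
  shows "\<exists>w\<in>weights. extreme_weight (images X (tolp c1 c2 d1)) w \<and>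
           (w $ 1, w $ 2) \<in> weight_segment j \<mu>"
proof (rule ccontr)
  assume contr: "\<not> ?thesis"
  let ?C = "pblp j c1 c2 d1" and ?T = "tolp c1 c2 d1"
  have "polyhedron X" using polyhedron_feasible_set assms(6) by simp
  then obtain V where V: "finite V" "V \<subseteq> X"
    and E: "\<And>C :: real^'n^2. {z. extreme_nondominated X C z} =
       (\<lambda>v. C *v v) ` {v \<in> V. widely_supported (images X C) (C *v v)}"
    using extreme_nondominated_finite_representatives[of X] by auto
  have "\<exists>m. \<forall>\<^sub>F \<nu> in at \<mu>. widely_supported (images X (?C \<nu>)) (?C \<nu> *v v) \<longleftrightarrow> m" if "v \<in> V" for v
    unfolding widely_supported_pblp_iff
  proof (rule meets_line_widely_eventually_constant[OF assms(8)])
    fix w assume w: "w extreme_point_of weight_component (images X ?T) (?T *v v)"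
    have "?T *v v \<in> images X ?T" using that V by (auto simp: images_def)
    then have "extreme_weight (images X ?T) w" using w by (auto simp: extreme_weight_def)
    moreover have "w \<in> weights" using w by (auto simp: extreme_point_of_def weight_component_def)
    ultimately show "line_form j \<mu> w \<noteq> 0" using contr weight_segment_iff assms(8) by blast
  qed
  then obtain m where "\<And>v. v \<in> V \<Longrightarrow>
      \<forall>\<^sub>F \<nu> in at \<mu>. widely_supported (images X (?C \<nu>)) (?C \<nu> *v v) \<longleftrightarrow> m v"
    by metis
  then have "\<forall>\<^sub>F \<nu> in at \<mu>.
      (\<forall>v\<in>V. widely_supported (images X (?C \<nu>)) (?C \<nu> *v v) \<longleftrightarrow> m v) \<and>
      (\<forall>v\<in>V. \<forall>v'\<in>V. ?C \<nu> *v v = ?C \<nu> *v v' \<longleftrightarrow> ?T *v v = ?T *v v')"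
    using V(1) by (intro eventually_conj eventually_ball_finite ballI eventually_pblp_eq_iff)
  then obtain \<delta> where "0 < \<delta>" and \<delta>: "\<And>\<nu>. \<lbrakk>\<nu> \<noteq> \<mu>; \<bar>\<nu> - \<mu>\<bar> < \<delta>\<rbrakk> \<Longrightarrow>
      (\<forall>v\<in>V. widely_supported (images X (?C \<nu>)) (?C \<nu> *v v) \<longleftrightarrow> m v) \<and>
      (\<forall>v\<in>V. \<forall>v'\<in>V. ?C \<nu> *v v = ?C \<nu> *v v' \<longleftrightarrow> ?T *v v = ?T *v v')"
    unfolding eventually_at dist_real_def by blast
  \<comment> \<open>The points of \<open>V\<close> whose images are extreme nondominated for all
    parameters near \<mu> other than \<mu> itself.\<close>
  define N where "N = {v \<in> V. m v}"
  \<comment> \<open>One point of \<open>N\<close> is kept for each triobjective image. Near \<mu>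
    the same pairs in \<open>V\<close> have equal biobjective images, so one \<open>S\<close> serves
    all these parameters.\<close>
  obtain S where S: "S \<subseteq> N" "inj_on (\<lambda>v. ?T *v v) S" "(\<lambda>v. ?T *v v) ` N = (\<lambda>v. ?T *v v) ` S"
    using subset_image_inj[of "(\<lambda>v. ?T *v v) ` N" "\<lambda>v. ?T *v v" N] by auto
  have min: "minimal_solution_set X (?C \<nu>) S" if "\<nu> \<noteq> \<mu>" "\<bar>\<nu> - \<mu>\<bar> < \<delta>" for \<nu>
  proof (rule minimal_solution_set_if_inj_on)
    have eq: "?C \<nu> *v v = ?C \<nu> *v v' \<longleftrightarrow> ?T *v v = ?T *v v'" if "v \<in> N" "v' \<in> N" for v v'
      using \<delta>[OF \<open>\<nu> \<noteq> \<mu>\<close> \<open>\<bar>\<nu> - \<mu>\<bar> < \<delta>\<close>] that by (simp add: N_def)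
    show "S \<subseteq> X" using S(1) V by (auto simp: N_def)
    show "inj_on (\<lambda>v. ?C \<nu> *v v) S"
      using S(1,2) eq unfolding inj_on_def by blast
    have "(\<lambda>v. ?C \<nu> *v v) ` S = (\<lambda>v. ?C \<nu> *v v) ` N"
    proof
      show "(\<lambda>v. ?C \<nu> *v v) ` N \<subseteq> (\<lambda>v. ?C \<nu> *v v) ` S"
      proof clarify
        fix v assume "v \<in> N"
        then obtain v' where "v' \<in> S" "?T *v v = ?T *v v'" using S(3) by blast
        then show "?C \<nu> *v v \<in> (\<lambda>v. ?C \<nu> *v v) ` S" using eq[OF \<open>v \<in> N\<close>, of v'] S(1) by blast
      qed
    qed (use S(1) in blast)
    also have "N = {v \<in> V. widely_supported (images X (?C \<nu>)) (?C \<nu> *v v)}"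
      using \<delta>[OF that] by (auto simp: N_def)
    finally show "(\<lambda>v. ?C \<nu> *v v) ` S = {z. extreme_nondominated X (?C \<nu>) z}"
      by (simp add: E)
  qed
  obtain \<epsilon>\<^sub>0 where "0 < \<epsilon>\<^sub>0" and no: "\<And>\<epsilon>. \<lbrakk>0 < \<epsilon>; \<epsilon> < \<epsilon>\<^sub>0\<rbrakk> \<Longrightarrow>
      \<not> (\<exists>S. minimal_solution_set X (?C (\<mu> + \<epsilon>)) S \<and> minimal_solution_set X (?C (\<mu> - \<epsilon>)) S)"
    using assms(9) unfolding breakpoint_def by blast
  \<comment> \<open>Small enough that \<open>S\<close> is minimal at both \<mu> + \<epsilon> and
    \<mu> - \<epsilon>, while the breakpoint condition still applies.\<close>
  define \<epsilon> where "\<epsilon> = min \<delta> \<epsilon>\<^sub>0 / 2"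
  have "0 < \<epsilon>" "\<epsilon> < \<delta>" "\<epsilon> < \<epsilon>\<^sub>0" using \<open>0 < \<delta>\<close> \<open>0 < \<epsilon>\<^sub>0\<close> by (auto simp: \<epsilon>_def)
  then show False using no[of \<epsilon>] min[of "\<mu> + \<epsilon>"] min[of "\<mu> - \<epsilon>"] by auto
qed

end
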